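(* Let $\mathtt{k}>0$, let $\nu\in\mathbb{R}$ with $2\nu>-3\mathtt{k}$, and let $c\in\mathbb{C}$. Then the following recurrence relations hold for $x>0$: $$\frac{d}{dx}\left(x^{\frac{\nu}{\mathtt{k}}}\mathtt{S}_{\nu,c}^{\mathtt{k}}(x)\right)=\frac{1}{\mathtt{k}}\,x^{\frac{\nu}{\mathtt{k}}}\,\mathtt{S}_{\nu-\mathtt{k},c}^{\mathtt{k}}(x);$$ $$\frac{d}{dx}\left(x^{-\frac{\nu}{\mathtt{k}}}\mathtt{S}_{\nu,c}^{\mathtt{k}}(x)\right)=\frac{2^{-\frac{\nu}{\mathtt{k}}}}{\sqrt{\pi}\,\Gamma_{\mathtt{k}}\left(\nu+\frac{3\mathtt{k}}{2}\right)}-c\,x^{-\frac{\nu}{\mathtt{k}}}\,\mathtt{S}_{\nu+\mathtt{k},c}^{\mathtt{k}}(x);$$ $$\frac{1}{\mathtt{k}}\mathtt{S}_{\nu-\mathtt{k},c}^{\mathtt{k}}(x)-c\,\mathtt{S}_{\nu+\mathtt{k},c}^{\mathtt{k}}(x)=2\frac{d}{dx}\mathtt{S}_{\nu,c}^{\mathtt{k}}(x)-\frac{(x/2)^{\frac{\nu}{\mathtt{k}}}}{\sqrt{\pi}\,\Gamma_{\mathtt{k}}\left(\nu+\frac{3\mathtt{k}}{2}\right)};$$ $$\frac{1}{\mathtt{k}}\mathtt{S}_{\nu-\mathtt{k},c}^{\mathtt{k}}(x)+c\,\mathtt{S}_{\nu+\mathtt{k},c}^{\mathtt{k}}(x)=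\frac{2\nu}{x\,\mathtt{k}}\mathtt{S}_{\nu,c}^{\mathtt{k}}(x)+\frac{(x/2)^{\frac{\nu}{\mathtt{k}}}}{\sqrt{\pi}\,\Gamma_{\mathtt{k}}\left(\nu+\frac{3\mathtt{k}}{2}\right)}.$$
   Context: For $\mathtt{k}>0$, the $\mathtt{k}$-gamma function is $\Gamma_{\mathtt{k}}(x)=\int_0^\infty t^{x-1}e^{-t^{\mathtt{k}}/\mathtt{k}}\,dt$ for $\Re(x)>0$, extended to other arguments by $\Gamma_{\mathtt{k}}(x+\mathtt{k})=x\,\Gamma_{\mathtt{k}}(x)$, with the convention that $1/\Gamma_{\mathtt{k}}$ equals $0$ at the poles $0,-\mathtt{k},-2\mathtt{k},\dots$ of $\Gamma_{\mathtt{k}}$; $\Gamma$ is the usual gamma function. For real $\nu$, the $\mathtt{k}$-Struve function is $$\mathtt{S}_{\nu,c}^{\mathtt{k}}(x)=\sum_{r=0}^{\infty}\frac{(-c)^r}{\Gamma_{\mathtt{k}}\left(r\mathtt{k}+\nu+\frac{3\mathtt{k}}{2}\right)\Gamma\left(r+\frac32\right)}\left(\frac{x}{2}\right)^{2r+\frac{\nu}{\mathtt{k}}+1}\qquad(x>0).$$ *)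

theory Defs
  imports "HOL-Analysis.Analysis"
begin

text \<open>
  The integral formula is used for \<open>Re z > 0\<close>, and the functional equation
  \<open>\<Gamma>\<^sub>k (z + k) = z \<Gamma>\<^sub>k z\<close>, solved for \<open>\<Gamma>\<^sub>k z\<close>, extends it to the left half plane.
  At the poles \<open>0, -k, -2k, \<dots>\<close> the recursion divides by zero, so the value is \<open>0\<close>
  there; as \<open>1 / 0 = 0\<close>, this yields the convention that \<open>1 / \<Gamma>\<^sub>k\<close> vanishes at the poles.
  Only \<open>k > 0\<close> is meaningful; the guard on \<open>k\<close> is for termination.
\<close>
function k_Gamma :: "real \<Rightarrow> complex \<Rightarrow> complex" where
  "k_Gamma k z =
     (if k > 0 \<and> Re z \<le> 0 then k_Gamma k (z + of_real k) / z
      else integral {0..} (\<lambda>t. of_real t powr (z - 1) * of_real (exp (- (t powr k) / k))))"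
  by auto
termination
proof (relation "Wellfounded.measure (\<lambda>(k, z). nat (\<lfloor>- Re z / k\<rfloor> + 1))")
  fix k :: real and z :: complex
  assume *: "k > 0 \<and> Re z \<le> 0"
  have "- Re (z + of_real k) / k = - Re z / k - 1"
    using * by (simp add: field_simps)
  then have "\<lfloor>- Re (z + of_real k) / k\<rfloor> = \<lfloor>- Re z / k\<rfloor> - 1"
    by linarith
  moreover have "\<lfloor>- Re z / k\<rfloor> \<ge> 0"
    using * by (simp add: divide_nonpos_pos)
  ultimately have "nat (\<lfloor>- Re (z + of_real k) / k\<rfloor> + 1) < nat (\<lfloor>- Re z / k\<rfloor> + 1)"
    by linarith
  then show "((k, z + of_real k), (k, z))
      \<in> Wellfounded.measure (\<lambda>(k, z). nat (\<lfloor>- Re z / k\<rfloor> + 1))"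
    by (simp only: in_measure prod.case)
qed simp

declare k_Gamma.simps [simp del]

text \<open>Intended for real arguments \<open>x > 0\<close>; the values are complex because \<open>c\<close> is.\<close>
definition k_Struve :: "real \<Rightarrow> real \<Rightarrow> complex \<Rightarrow> real \<Rightarrow> complex" where
  "k_Struve k \<nu> c x =
     (\<Sum>r. (- c) ^ r
           / (k_Gamma k (of_real (real r * k + \<nu> + 3 * k / 2)) * of_real (Gamma (real r + 3 / 2)))
           * of_real ((x / 2) powr (2 * real r + \<nu> / k + 1)))"

end

theory Submission
  imports Defs
begin

text \<open>
  Everything rests on the functional equation \<open>\<Gamma>\<^sub>k (z + k) = z \<Gamma>\<^sub>k z\<close>. The substitution
  \<open>s = t\<^sup>k / k\<close> in the defining integral gives \<open>\<Gamma>\<^sub>k z = k powr (z / k - 1) * \<Gamma> (z / k)\<close> for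
  \<open>Re z > 0\<close>, so there the equation is inherited from the classical Gamma function, while on the
  left half plane it is the definition of the extension. Written for the reciprocal, it holds for
  every \<open>z\<close>, poles included (\<open>inverse_k_Gamma\<close>).

  The summands \<open>t\<^sub>r\<close> of the series for \<open>S\<^sub>\<nu>\<close> at \<open>x\<close> are multiples of \<open>x powr p\<^sub>r\<close> with
  \<open>p\<^sub>r = 2 r + \<nu> / k + 1\<close>, so the derivative of \<open>x powr \<beta> * S\<^sub>\<nu>\<close> is \<open>x powr (\<beta> - 1)\<close> times the sum of
  \<open>(p\<^sub>r + \<beta>) t\<^sub>r\<close>; differentiation under the sum is legitimate because, up to a power of \<open>x\<close>, the
  series is an entire power series in \<open>x\<^sup>2\<close>. Two choices of \<open>\<beta>\<close> make the factor \<open>p\<^sub>r + \<beta>\<close> cancel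
  against one of the two Gamma factors:
  for \<open>\<beta> = \<nu> / k\<close> it is \<open>2 / k\<close> times \<open>r k + \<nu> + k / 2\<close>, which lowers \<open>\<nu>\<close> by \<open>k\<close>
  (\<open>k_Struve_term_lower\<close>), and for \<open>\<beta> = - \<nu> / k\<close> it is \<open>2 (r + 1 / 2)\<close>, which
  raises \<open>\<nu>\<close> by \<open>k\<close> and lowers the index \<open>r\<close> (\<open>k_Struve_term_raise\<close>). In the second case the summand
  \<open>r = 0\<close> has no partner and is the explicit term with \<open>sqrt pi\<close>. Solving both derivative formulas for
  \<open>S\<^sub>\<nu>'\<close> and adding or subtracting yields the two remaining relations.
\<close>

section \<open>The functional equation of the k-Gamma function\<close>

text \<open>
  The substitution \<open>s = t\<^sup>k / k\<close> turns \<open>s powr (z / k - 1) * exp (- s) ds\<close> into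
  \<open>k powr (1 - z / k) * t powr (z - 1) * exp (- t\<^sup>k / k) dt\<close>.
\<close>
lemma k_Gamma_conv_Gamma:
  assumes "k > 0" and "Re z > 0"
  shows "k_Gamma k z = of_real k powr (z / of_real k - 1) * Gamma (z / of_real k)"
proof -
  define w where "w = z / of_real k"
  have w: "Re w > 0"
    using assms by (simp add: w_def)
  have zw: "z = of_real k * w"
    using assms by (simp add: w_def)
  define f where "f = (\<lambda>s::real. of_real s powr (w - 1) / of_real (exp s) :: complex)"
  define g where "g = (\<lambda>t::real. t powr k / k)"
  define h where "h = (\<lambda>t. of_real t powr (z - 1) * of_real (exp (- (t powr k) / k)) :: complex)"
  have g': "(g has_field_derivative t powr (k - 1)) (at t within {0<..})" if "t \<in> {0<..}" for t
    unfolding g_def using that assms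
    by (auto intro!: derivative_eq_intros)
  have inj: "inj_on g {0<..}"
  proof (rule inj_on_inverseI)
    show "(k * g t) powr (1 / k) = t" if "t \<in> {0<..}" for t
      using that assms by (simp add: g_def powr_powr)
  qed
  have img: "g ` {0<..} = {0<..}"
  proof (intro equalityI subsetI)
    fix s :: real
    assume s: "s \<in> {0<..}"
    then have "s = g ((s * k) powr (1 / k))"
      using assms by (simp add: g_def powr_powr)
    then show "s \<in> g ` {0<..}"
      using s assms by (intro image_eqI[where x = "(s * k) powr (1 / k)"]) auto
  qed (use assms in \<open>auto simp: g_def\<close>)
  have f: "f absolutely_integrable_on {0<..}" "integral {0<..} f = Gamma w"
    unfolding f_def
    using absolutely_integrable_Gamma_integral'[OF w] Gamma_integral_complex'[OF w]
    by (auto intro: integral_unique)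
  have "integral {0<..} (\<lambda>t. \<bar>t powr (k - 1)\<bar> *\<^sub>R f (g t)) = Gamma w"
    using has_absolute_integral_change_of_variables_real[OF _ g' inj, of f "Gamma w"] f
    by (simp add: img)
  moreover have "\<bar>t powr (k - 1)\<bar> *\<^sub>R f (g t) = of_real k powr (1 - w) * h t"
    if "t \<in> {0<..}" for t
  proof -
    have t: "t > 0"
      using that by simp
    have ln: "ln (t powr k / k) = k * ln t - ln k"
      using t assms by (simp add: ln_div ln_powr)
    have pow: "of_real (t powr k / k) powr (w - 1)
        = exp ((w - 1) * of_real (k * ln t - ln k) :: complex)"
      using t assms ln by (simp add: powr_def Ln_of_real flip: of_real_divide)
    have "of_real (t powr (k - 1)) * of_real (t powr k / k) powr (w - 1)
        = of_real k powr (1 - w) * of_real t powr (z - 1)"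
      unfolding pow using t assms
      by (simp add: powr_def Ln_of_real zw exp_of_real[symmetric] exp_add[symmetric] algebra_simps)
    then show ?thesis
      by (simp add: f_def h_def g_def scaleR_conv_of_real exp_minus field_simps)
  qed
  ultimately have "integral {0<..} (\<lambda>t. of_real k powr (1 - w) * h t) = Gamma w"
    by (metis (no_types, lifting) Henstock_Kurzweil_Integration.integral_cong)
  then have "of_real k powr (1 - w) * integral {0<..} h = Gamma w"
    by simp
  then have "integral {0<..} h = of_real k powr (w - 1) * Gamma w"
    using assms by (auto simp: powr_def exp_diff field_simps)
  moreover have "integral {0..} h = integral {0<..} h"
  proof (rule integral_spike_set)
    show "negligible {t \<in> {0..} - {0<..}. h t \<noteq> 0}"
      by (rule negligible_subset[of "{0}"]) auto
    show "negligible {t \<in> {0<..} - {0..}. h t \<noteq> 0}"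
      by (rule negligible_subset[of "{}"]) auto
  qed
  ultimately show ?thesis
    using assms by (simp add: k_Gamma.simps[of k z] h_def w_def)
qed

text \<open>
  Stated for the reciprocal, the functional equation needs no exception: at \<open>z = 0\<close> both sides vanish,
  and at the other poles the value \<open>0\<close> of \<open>\<Gamma>\<^sub>k\<close> is inherited from \<open>z + k\<close>.
\<close>
lemma inverse_k_Gamma:
  assumes "k > 0"
  shows "inverse (k_Gamma k z) = z * inverse (k_Gamma k (z + of_real k))"
proof (cases "Re z \<le> 0")
  case True
  then show ?thesis
    using assms by (simp add: k_Gamma.simps[of k z] divide_inverse)
next
  case False
  define w where "w = z / of_real k"
  have "Re w > 0" and z: "z = of_real k * w"
    using False assms by (simp_all add: w_def)
  then have w: "w \<noteq> 0" "w \<notin> \<int>\<^sub>\<le>\<^sub>0"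
    by (auto elim!: nonpos_Ints_cases)
  have "(z + of_real k) / of_real k = w + 1"
    using assms by (simp add: w_def field_simps)
  then have "k_Gamma k (z + of_real k) = of_real k powr w * Gamma (w + 1)"
    using False assms by (simp add: k_Gamma_conv_Gamma)
  also have "\<dots> = of_real k powr w * w * Gamma w"
    using w by (simp add: Gamma_plus1)
  also have "of_real k powr w = of_real k * of_real k powr (w - 1)"
    using assms by (simp add: powr_diff)
  finally have "k_Gamma k (z + of_real k) = z * k_Gamma k z"
    using False assms by (simp add: k_Gamma_conv_Gamma flip: w_def) (simp add: z)
  then show ?thesis
    using w assms by (simp add: field_simps z)
qed

section \<open>Differentiating an even power series times a real power\<close>

text \<open>
  The sum is \<open>x powr \<alpha> * G (x\<^sup>2)\<close> with the entire function \<open>G w = (\<Sum>r. A r * w ^ r)\<close>, so the chain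
  rule gives the derivative, and \<open>x * G' (x\<^sup>2)\<close> is resummed through \<open>w * G' w = (\<Sum>r. r * A r * w ^ r)\<close>.
\<close>
lemma powr_series_has_vector_derivative:
  fixes A :: "nat \<Rightarrow> complex" and \<alpha> x :: real
  assumes A: "\<And>w. summable (\<lambda>r. A r * w ^ r)" and x: "x > 0"
  obtains D where
    "(\<lambda>r. A r * of_real ((2 * real r + \<alpha>) * x powr (2 * real r + \<alpha> - 1))) sums D"
    "((\<lambda>y. \<Sum>r. A r * of_real (y powr (2 * real r + \<alpha>))) has_vector_derivative D) (at x)"
proof -
  define G where "G = (\<lambda>w. \<Sum>r. A r * w ^ r)"
  define G' where "G' = (\<lambda>w. \<Sum>r. diffs A r * w ^ r)"
  have pow: "y powr (2 * real r + \<beta>) = y powr \<beta> * (y\<^sup>2) ^ r" if "y > 0" for y \<beta> r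
  proof -
    have "y powr (2 * real r) = y ^ (2 * r)"
      using that powr_realpow[of y "2 * r"] by simp
    then show ?thesis
      using that by (simp add: powr_add power_mult)
  qed
  define u where "u = complex_of_real (x\<^sup>2)"
  have G: "(\<lambda>r. A r * w ^ r) sums G w" for w
    using A by (simp add: G_def summable_sums)
  have "(\<lambda>r. of_nat r * A r * u ^ (r - Suc 0)) sums G' u"
    unfolding G'_def by (intro diffs_equiv termdiff_converges_all A)
  then have "(\<lambda>r. u * (of_nat r * A r * u ^ (r - Suc 0))) sums (u * G' u)"
    by (rule sums_mult)
  then have G'u: "(\<lambda>r. of_nat r * A r * u ^ r) sums (u * G' u)"
  proof (rule sums_cong[THEN iffD1, rotated])
    show "u * (of_nat r * A r * u ^ (r - Suc 0)) = of_nat r * A r * u ^ r" for r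
      by (cases r) simp_all
  qed
  define D where "D = of_real (x powr (\<alpha> - 1)) * (2 * (u * G' u) + of_real \<alpha> * G u)"
  show ?thesis
  proof
    have "(\<lambda>r. of_real (x powr (\<alpha> - 1)) * (2 * (of_nat r * A r * u ^ r) + of_real \<alpha> * (A r * u ^ r)))
        sums D"
      unfolding D_def by (intro sums_mult sums_add G'u G)
    moreover have "of_real (x powr (\<alpha> - 1)) * (2 * (of_nat r * A r * u ^ r) + of_real \<alpha> * (A r * u ^ r))
        = A r * of_real ((2 * real r + \<alpha>) * x powr (2 * real r + \<alpha> - 1))" for r
      using pow[OF x, of r "\<alpha> - 1"] by (simp add: u_def algebra_simps)
    ultimately show "(\<lambda>r. A r * of_real ((2 * real r + \<alpha>) * x powr (2 * real r + \<alpha> - 1))) sums D"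
      by simp
    have "(G has_field_derivative G' u) (at (of_real (x\<^sup>2)))"
      unfolding G_def G'_def u_def by (rule termdiffs_strong_converges_everywhere) (rule A)
    moreover have "((\<lambda>y. of_real (y\<^sup>2)) has_vector_derivative complex_of_real (2 * x)) (at x)"
      by (intro has_vector_derivative_of_real) (auto intro!: derivative_eq_intros)
    ultimately have "((\<lambda>y. G (of_real (y\<^sup>2))) has_vector_derivative of_real (2 * x) * G' u) (at x)"
      using field_vector_diff_chain_at[of "\<lambda>y. of_real (y\<^sup>2)" "of_real (2 * x)" x G "G' u"]
      by (simp add: o_def)
    moreover have "((\<lambda>y. of_real (y powr \<alpha>)) has_vector_derivative
        complex_of_real (\<alpha> * x powr (\<alpha> - 1))) (at x)"
      using x by (intro has_vector_derivative_of_real) (auto intro!: derivative_eq_intros)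
    ultimately have "((\<lambda>y. of_real (y powr \<alpha>) * G (of_real (y\<^sup>2))) has_vector_derivative
        of_real (x powr \<alpha>) * (of_real (2 * x) * G' u)
          + of_real (\<alpha> * x powr (\<alpha> - 1)) * G (of_real (x\<^sup>2))) (at x)"
      by (intro has_vector_derivative_mult)
    moreover have "of_real (x powr \<alpha>) * (of_real (2 * x) * G' u)
          + of_real (\<alpha> * x powr (\<alpha> - 1)) * G (of_real (x\<^sup>2)) = D"
    proof -
      have "x powr \<alpha> = x * x powr (\<alpha> - 1)"
        using x by (simp add: powr_diff)
      then show ?thesis
        by (simp add: D_def u_def power2_eq_square algebra_simps)
    qed
    ultimately have "((\<lambda>y. of_real (y powr \<alpha>) * G (of_real (y\<^sup>2))) has_vector_derivative D) (at x)"
      by simp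
    then show "((\<lambda>y. \<Sum>r. A r * of_real (y powr (2 * real r + \<alpha>))) has_vector_derivative D) (at x)"
    proof (rule has_vector_derivative_transform_within_open)
      show "open {0::real<..}" "x \<in> {0<..}"
        using x by auto
      fix y :: real
      assume "y \<in> {0<..}"
      then have y: "y > 0"
        by simp
      have "(\<lambda>r. of_real (y powr \<alpha>) * (A r * of_real (y\<^sup>2) ^ r)) sums (of_real (y powr \<alpha>) * G (of_real (y\<^sup>2)))"
        by (intro sums_mult G)
      then have "(\<lambda>r. A r * of_real (y powr (2 * real r + \<alpha>))) sums (of_real (y powr \<alpha>) * G (of_real (y\<^sup>2)))"
        using pow[OF y] by (simp add: algebra_simps)
      then show "of_real (y powr \<alpha>) * G (of_real (y\<^sup>2)) = (\<Sum>r. A r * of_real (y powr (2 * real r + \<alpha>)))"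
        by (rule sums_unique)
    qed
  qed
qed

section \<open>The summands of the k-Struve series\<close>

definition k_Struve_coeff :: "real \<Rightarrow> real \<Rightarrow> complex \<Rightarrow> nat \<Rightarrow> complex" where
  "k_Struve_coeff k \<nu> c r =
     (- c) ^ r / (k_Gamma k (of_real (real r * k + \<nu> + 3 * k / 2)) * of_real (Gamma (real r + 3 / 2)))"

definition k_Struve_term :: "real \<Rightarrow> real \<Rightarrow> complex \<Rightarrow> real \<Rightarrow> nat \<Rightarrow> complex" where
  "k_Struve_term k \<nu> c x r =
     k_Struve_coeff k \<nu> c r * of_real ((x / 2) powr (2 * real r + \<nu> / k + 1))"

lemma k_Struve_eq_suminf: "k_Struve k \<nu> c x = (\<Sum>r. k_Struve_term k \<nu> c x r)"
  by (simp add: k_Struve_def k_Struve_term_def k_Struve_coeff_def)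

lemma Gamma_half_integer_Suc:
  "Gamma (real (Suc r) + 3 / 2) = (real r + 3 / 2) * Gamma (real r + 3 / 2)"
proof -
  have "real r + 3 / 2 \<notin> \<int>\<^sub>\<le>\<^sub>0"
    by (auto elim!: nonpos_Ints_cases)
  then show ?thesis
    using Gamma_plus1[of "real r + 3 / 2"] by (simp add: algebra_simps)
qed

text \<open>
  Once \<open>r k + \<nu> + 3 k / 2\<close> is positive, consecutive coefficients have ratio
  \<open>- c / ((r k + \<nu> + 3 k / 2) (r + 3 / 2))\<close>, which tends to \<open>0\<close>; so the power series they generate
  is entire.
\<close>
lemma summable_k_Struve_coeff:
  assumes k: "k > 0"
  shows "summable (\<lambda>r. k_Struve_coeff k \<nu> c r * w ^ r)"
proof -
  \<comment> \<open>From \<open>N\<close> on, \<open>r k + \<nu> + 3 k / 2\<close> exceeds \<open>2 * norm (c * w) + 1\<close>, so the ratio of summands is at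
    most \<open>1 / 2\<close>; the summand \<open>1\<close> keeps it positive when \<open>c * w = 0\<close>.\<close>
  obtain N :: nat where N: "(2 * norm (c * w) + 1 - (\<nu> + 3 * k / 2)) / k < real N"
    using reals_Archimedean2 by blast
  show ?thesis
  proof (rule summable_ratio_test[of "1 / 2" N])
    fix r
    assume r: "N \<le> r"
    define z where "z = real r * k + \<nu> + 3 * k / 2"
    define d where "d = z * (real r + 3 / 2)"
    have "2 * norm (c * w) + 1 - (\<nu> + 3 * k / 2) < real N * k"
      using N k by (simp add: pos_divide_less_eq)
    also have "\<dots> \<le> real r * k"
      using r k by (intro mult_right_mono) auto
    finally have z: "z > 2 * norm (c * w)" "z > 0"
      using norm_ge_zero[of "c * w"] unfolding z_def by linarith+
    have "z \<le> d"
      using z mult_left_mono[of 1 "real r + 3 / 2" z] by (simp add: d_def)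
    with z have d: "2 * norm (c * w) \<le> d" and "d > 0"
      by linarith+
    have "k_Struve_coeff k \<nu> c r * (- c) = of_real d * k_Struve_coeff k \<nu> c (Suc r)"
    proof -
      have z': "real (Suc r) * k + \<nu> + 3 * k / 2 = z + k"
        by (simp add: z_def algebra_simps)
      define a where "a = complex_of_real (real r + 3 / 2)"
      have a: "a \<noteq> 0"
        unfolding a_def by (subst of_real_eq_0_iff) linarith
      have "inverse (k_Gamma k (of_real z)) = of_real z * inverse (k_Gamma k (of_real (z + k)))"
        using inverse_k_Gamma[OF k, of "of_real z"] by simp
      then show ?thesis
        unfolding k_Struve_coeff_def z' z_def[symmetric] d_def Gamma_half_integer_Suc of_real_mult
          a_def[symmetric]
        unfolding divide_inverse inverse_mult_distrib power_Suc
        using a by simp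
    qed
    then have "k_Struve_coeff k \<nu> c (Suc r) = k_Struve_coeff k \<nu> c r * (- c) / of_real d"
      using \<open>d > 0\<close> by simp
    then have "k_Struve_coeff k \<nu> c (Suc r) * w ^ Suc r
        = - (c * w) / of_real d * (k_Struve_coeff k \<nu> c r * w ^ r)"
      by simp
    also have "norm \<dots> = norm (c * w) / d * norm (k_Struve_coeff k \<nu> c r * w ^ r)"
      using \<open>d > 0\<close> by (simp add: norm_mult norm_divide)
    also have "\<dots> \<le> 1 / 2 * norm (k_Struve_coeff k \<nu> c r * w ^ r)"
      using d \<open>d > 0\<close> by (intro mult_right_mono) (simp_all add: field_simps)
    finally show "norm (k_Struve_coeff k \<nu> c (Suc r) * w ^ Suc r)
        \<le> 1 / 2 * norm (k_Struve_coeff k \<nu> c r * w ^ r)" .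
  qed simp
qed

lemma k_Struve_term_conv_power:
  assumes "x > 0"
  shows "k_Struve_term k \<nu> c x r =
    of_real ((x / 2) powr (\<nu> / k + 1)) * (k_Struve_coeff k \<nu> c r * of_real ((x / 2)\<^sup>2) ^ r)"
proof -
  have "(x / 2) powr (2 * real r) = (x / 2) ^ (2 * r)"
    using assms powr_realpow[of "x / 2" "2 * r"] by simp
  then have "(x / 2) powr (2 * real r + (\<nu> / k + 1)) = (x / 2) powr (\<nu> / k + 1) * ((x / 2)\<^sup>2) ^ r"
    by (simp add: powr_add power_mult)
  then show ?thesis
    by (simp add: k_Struve_term_def add.assoc)
qed

lemma k_Struve_term_sums:
  assumes "k > 0" "x > 0"
  shows "k_Struve_term k \<nu> c x sums k_Struve k \<nu> c x"
proof -
  have "summable (\<lambda>r. k_Struve_term k \<nu> c x r)"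
    unfolding k_Struve_term_conv_power[OF assms(2)]
    by (intro summable_mult summable_k_Struve_coeff assms)
  then show ?thesis
    by (simp add: k_Struve_eq_suminf summable_sums)
qed

text \<open>
  The factor produced by differentiating \<open>x powr (\<nu> / k)\<close> times the summand is \<open>2 / k\<close> times
  \<open>z = r k + \<nu> + k / 2\<close>, and \<open>z / \<Gamma>\<^sub>k (z + k) = 1 / \<Gamma>\<^sub>k z\<close>. When \<open>z\<close> is not positive, as for \<open>r = 0\<close> and
  \<open>2 \<nu> \<le> - k\<close>, this uses the extension of \<open>\<Gamma>\<^sub>k\<close> and its convention at the poles.
\<close>
lemma k_Struve_term_lower:
  assumes k: "k > 0" and x: "x > 0"
  shows "of_real (2 * real r + \<nu> / k + 1 + \<nu> / k) * k_Struve_term k \<nu> c x r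
    = of_real (x / k) * k_Struve_term k (\<nu> - k) c x r"
proof -
  define z where "z = real r * k + \<nu> + k / 2"
  have z: "real r * k + \<nu> + 3 * k / 2 = z + k" "real r * k + (\<nu> - k) + 3 * k / 2 = z"
      "2 * real r + \<nu> / k + 1 + \<nu> / k = 2 / k * z"
    using k by (simp_all add: z_def field_simps)
  have p: "2 * real r + \<nu> / k + 1 = (2 * real r + (\<nu> - k) / k + 1) + 1"
    using k by (simp add: field_simps)
  have e: "(x / 2) powr (2 * real r + \<nu> / k + 1) = (x / 2) powr (2 * real r + (\<nu> - k) / k + 1) * (x / 2)"
    unfolding p powr_add using x by simp
  have cancel: "of_real (2 / k * z) * (w / (a * b) * of_real (P * (x / 2)))
      = of_real (x / k) * (w / (a' * b) * of_real P)"
    if "inverse a' = of_real z * inverse a" for w a a' b :: complex and P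
    unfolding divide_inverse inverse_mult_distrib of_real_mult that by simp
  have "inverse (k_Gamma k (of_real z)) = of_real z * inverse (k_Gamma k (of_real (z + k)))"
    using inverse_k_Gamma[OF k, of "of_real z"] by simp
  then show ?thesis
    unfolding k_Struve_term_def k_Struve_coeff_def z e by (rule cancel)
qed

text \<open>
  The factor produced by differentiating \<open>x powr (- \<nu> / k)\<close> times the summand of index \<open>r + 1\<close> is
  \<open>2 (r + 3 / 2)\<close>, which cancels against \<open>\<Gamma> (r + 5 / 2) = (r + 3 / 2) \<Gamma> (r + 3 / 2)\<close>.
\<close>
lemma k_Struve_term_raise:
  assumes k: "k > 0" and x: "x > 0"
  shows "of_real (2 * real (Suc r) + \<nu> / k + 1 + - \<nu> / k) * k_Struve_term k \<nu> c x (Suc r)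
    = - c * of_real x * k_Struve_term k (\<nu> + k) c x r"
proof -
  have g: "real (Suc r) * k + \<nu> + 3 * k / 2 = real r * k + (\<nu> + k) + 3 * k / 2"
    by (simp add: algebra_simps)
  have f: "2 * real (Suc r) + \<nu> / k + 1 + - \<nu> / k = 2 * (real r + 3 / 2)"
    by simp
  have p: "2 * real (Suc r) + \<nu> / k + 1 = (2 * real r + (\<nu> + k) / k + 1) + 1"
    using k by (simp add: field_simps)
  have e: "(x / 2) powr (2 * real (Suc r) + \<nu> / k + 1)
      = (x / 2) powr (2 * real r + (\<nu> + k) / k + 1) * (x / 2)"
    unfolding p powr_add using x by simp
  define a where "a = complex_of_real (real r + 3 / 2)"
  have "a \<noteq> 0"
    unfolding a_def by (subst of_real_eq_0_iff) linarith
  then show ?thesis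
    unfolding k_Struve_term_def k_Struve_coeff_def g f e Gamma_half_integer_Suc of_real_mult
      a_def[symmetric]
    unfolding divide_inverse inverse_mult_distrib power_Suc
    by simp
qed

text \<open>The first summand has no counterpart of lower index; its value comes from \<open>\<Gamma> (3 / 2) = sqrt pi / 2\<close>.\<close>
lemma k_Struve_term_0:
  assumes x: "x > 0"
  shows "k_Struve_term k \<nu> c x 0
    = of_real x * of_real ((x / 2) powr (\<nu> / k)) / (of_real (sqrt pi) * k_Gamma k (of_real (\<nu> + 3 * k / 2)))"
proof -
  have "(1 / 2 :: real) \<notin> \<int>\<^sub>\<le>\<^sub>0"
    by (auto dest: nonpos_Ints_nonpos)
  then have G: "Gamma (real 0 + 3 / 2) = sqrt pi / 2"
    using Gamma_plus1[of "1 / 2 :: real"] Gamma_one_half_real by simp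
  have "k_Struve_term k \<nu> c x 0 = 1 / (k_Gamma k (of_real (\<nu> + 3 * k / 2)) * of_real (sqrt pi / 2))
      * of_real ((x / 2) powr (\<nu> / k) * (x / 2))"
    unfolding k_Struve_term_def k_Struve_coeff_def G using x by (simp add: powr_add)
  then show ?thesis
    by (simp add: mult_ac)
qed

text \<open>
  The summands are multiples of powers of \<open>x\<close> with exponents \<open>2 r + \<nu> / k + 1\<close>, so multiplying by
  \<open>x powr \<beta>\<close> and differentiating multiplies them by the shifted exponent and \<open>x powr (\<beta> - 1)\<close>.
\<close>
lemma powr_times_k_Struve_has_vector_derivative:
  assumes k: "k > 0" and x: "x > 0"
    and sums: "(\<lambda>r. of_real (2 * real r + \<nu> / k + 1 + \<beta>) * k_Struve_term k \<nu> c x r) sums E"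
  shows "((\<lambda>y. of_real (y powr \<beta>) * k_Struve k \<nu> c y) has_vector_derivative
    of_real (x powr (\<beta> - 1)) * E) (at x)"
proof -
  define A where
    "A = (\<lambda>r. k_Struve_coeff k \<nu> c r * of_real ((1 / 2) powr (2 * real r + \<nu> / k + 1)))"
  define \<alpha> where "\<alpha> = \<nu> / k + 1 + \<beta>"
  \<comment> \<open>The powers of \<open>1 / 2\<close> rescale the argument of the coefficient series by \<open>1 / 4\<close>.\<close>
  have half: "(1 / 2 :: real) powr (2 * real r + \<nu> / k + 1) = (1 / 2) powr (\<nu> / k + 1) * (1 / 4) ^ r" for r
    using powr_realpow[of "1 / 2 :: real" "2 * r"]
    by (simp add: powr_add power_mult power2_eq_square)
  have A: "summable (\<lambda>r. A r * w ^ r)" for w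
  proof -
    have "A r * w ^ r = of_real ((1 / 2) powr (\<nu> / k + 1)) * (k_Struve_coeff k \<nu> c r * (w / 4) ^ r)" for r
      unfolding A_def half by (simp add: power_divide)
    then show ?thesis
      by (simp add: summable_mult summable_k_Struve_coeff k)
  qed
  have term_eq: "k_Struve_term k \<nu> c y r = A r * of_real (y powr (2 * real r + \<nu> / k + 1))" if "y > 0" for y r
    using that powr_mult[of y "1 / 2" "2 * real r + \<nu> / k + 1"] by (simp add: k_Struve_term_def A_def)
  obtain D where D: "(\<lambda>r. A r * of_real ((2 * real r + \<alpha>) * x powr (2 * real r + \<alpha> - 1))) sums D"
    and der: "((\<lambda>y. \<Sum>r. A r * of_real (y powr (2 * real r + \<alpha>))) has_vector_derivative D) (at x)"
    using powr_series_has_vector_derivative[OF A x] by blast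
  have "A r * of_real ((2 * real r + \<alpha>) * x powr (2 * real r + \<alpha> - 1))
      = of_real (x powr (\<beta> - 1)) * (of_real (2 * real r + \<nu> / k + 1 + \<beta>) * k_Struve_term k \<nu> c x r)" for r
  proof -
    have "2 * real r + \<alpha> - 1 = (\<beta> - 1) + (2 * real r + \<nu> / k + 1)"
      by (simp add: \<alpha>_def)
    then have "x powr (2 * real r + \<alpha> - 1) = x powr (\<beta> - 1) * x powr (2 * real r + \<nu> / k + 1)"
      by (simp only: powr_add)
    then show ?thesis
      unfolding term_eq[OF x] by (simp add: \<alpha>_def add.assoc)
  qed
  with D have "(\<lambda>r. of_real (x powr (\<beta> - 1)) *
      (of_real (2 * real r + \<nu> / k + 1 + \<beta>) * k_Struve_term k \<nu> c x r)) sums D"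
    by simp
  then have "D = of_real (x powr (\<beta> - 1)) * E"
    using sums_mult[OF sums] sums_unique2 by blast
  with der have "((\<lambda>y. \<Sum>r. A r * of_real (y powr (2 * real r + \<alpha>))) has_vector_derivative
      of_real (x powr (\<beta> - 1)) * E) (at x)"
    by simp
  then show ?thesis
  proof (rule has_vector_derivative_transform_within_open)
    show "open {0::real<..}" "x \<in> {0<..}"
      using x by auto
    fix y :: real
    assume "y \<in> {0<..}"
    then have y: "y > 0"
      by simp
    have "of_real (y powr \<beta>) * k_Struve_term k \<nu> c y r = A r * of_real (y powr (2 * real r + \<alpha>))" for r
    proof -
      have "2 * real r + \<alpha> = \<beta> + (2 * real r + \<nu> / k + 1)"
        by (simp add: \<alpha>_def)
      then have "y powr (2 * real r + \<alpha>) = y powr \<beta> * y powr (2 * real r + \<nu> / k + 1)"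
        by (simp only: powr_add)
      then show ?thesis
        unfolding term_eq[OF y] by simp
    qed
    then show "(\<Sum>r. A r * of_real (y powr (2 * real r + \<alpha>))) = of_real (y powr \<beta>) * k_Struve k \<nu> c y"
      using sums_mult[OF k_Struve_term_sums[OF k y], of "of_real (y powr \<beta>)" \<nu> c]
      by (simp add: sums_iff)
  qed
qed

section \<open>The recurrence relations\<close>

lemma k_Struve_derivative_lower:
  assumes k: "k > 0" and x: "x > 0"
  shows "((\<lambda>y. of_real (y powr (\<nu> / k)) * k_Struve k \<nu> c y) has_vector_derivative
    of_real (1 / k) * of_real (x powr (\<nu> / k)) * k_Struve k (\<nu> - k) c x) (at x)"
proof -
  have "(\<lambda>r. of_real (2 * real r + \<nu> / k + 1 + \<nu> / k) * k_Struve_term k \<nu> c x r) sums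
      (of_real (x / k) * k_Struve k (\<nu> - k) c x)"
    unfolding k_Struve_term_lower[OF k x] by (intro sums_mult k_Struve_term_sums k x)
  then have "((\<lambda>y. of_real (y powr (\<nu> / k)) * k_Struve k \<nu> c y) has_vector_derivative
      of_real (x powr (\<nu> / k - 1)) * (of_real (x / k) * k_Struve k (\<nu> - k) c x)) (at x)"
    by (rule powr_times_k_Struve_has_vector_derivative[OF k x])
  moreover have "x powr (\<nu> / k) = x powr (\<nu> / k - 1) * x"
    using x by (simp add: powr_diff)
  ultimately show ?thesis
    by (simp add: mult_ac)
qed

lemma powr_minus_cancel:
  fixes x :: real
  assumes "x > 0"
  shows "x powr (- a) * x powr a = 1"
  using assms powr_add[of x "- a" a] by simp

lemma powr_half:
  fixes x :: real
  assumes "x > 0"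
  shows "(x / 2) powr a = x powr a * 2 powr (- a)"
  using assms powr_divide[of x 2 a] powr_minus_divide[of 2 a] by simp

lemma k_Struve_derivative_raise:
  assumes k: "k > 0" and x: "x > 0"
  shows "((\<lambda>y. of_real (y powr (- \<nu> / k)) * k_Struve k \<nu> c y) has_vector_derivative
    of_real (2 powr (- \<nu> / k)) / (of_real (sqrt pi) * k_Gamma k (of_real (\<nu> + 3 * k / 2)))
      - c * of_real (x powr (- \<nu> / k)) * k_Struve k (\<nu> + k) c x) (at x)"
proof -
  define t0 where "t0 = k_Struve_term k \<nu> c x 0"
  define f where "f = (\<lambda>r. of_real (2 * real r + \<nu> / k + 1 + - \<nu> / k) * k_Struve_term k \<nu> c x r)"
  have "(\<lambda>r. f (Suc r)) sums (- c * of_real x * k_Struve k (\<nu> + k) c x)"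
    unfolding f_def k_Struve_term_raise[OF k x] by (intro sums_mult k_Struve_term_sums k x)
  then have "f sums (- c * of_real x * k_Struve k (\<nu> + k) c x + f 0)"
    by (rule sums_Suc)
  moreover have "f 0 = t0"
    by (simp add: f_def t0_def)
  ultimately have "f sums (- c * of_real x * k_Struve k (\<nu> + k) c x + t0)"
    by (simp only:)
  then have "((\<lambda>y. of_real (y powr (- \<nu> / k)) * k_Struve k \<nu> c y) has_vector_derivative
      of_real (x powr (- \<nu> / k - 1)) * (- c * of_real x * k_Struve k (\<nu> + k) c x + t0)) (at x)"
    unfolding f_def by (rule powr_times_k_Struve_has_vector_derivative[OF k x])
  moreover have p: "x powr (- \<nu> / k) = x powr (- \<nu> / k - 1) * x"
    using x by (simp add: powr_diff)
  moreover have "of_real (x powr (- \<nu> / k - 1)) * t0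
      = of_real (2 powr (- \<nu> / k)) / (of_real (sqrt pi) * k_Gamma k (of_real (\<nu> + 3 * k / 2)))"
  proof -
    have "x powr (- \<nu> / k - 1) * (x * (x / 2) powr (\<nu> / k)) = x powr (- (\<nu> / k)) * (x / 2) powr (\<nu> / k)"
      unfolding minus_divide_left p by (rule mult.assoc[symmetric])
    also have "\<dots> = 2 powr (- \<nu> / k)"
      unfolding powr_half[OF x] mult.assoc[symmetric] powr_minus_cancel[OF x] by simp
    finally have "x powr (- \<nu> / k - 1) * (x * (x / 2) powr (\<nu> / k)) = 2 powr (- \<nu> / k)" .
    then have "complex_of_real (x powr (- \<nu> / k - 1)) * (of_real x * of_real ((x / 2) powr (\<nu> / k)))
        = of_real (2 powr (- \<nu> / k))"
      by (simp only: flip: of_real_mult)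
    then show ?thesis
      unfolding t0_def k_Struve_term_0[OF x] times_divide_eq_right by (rule arg_cong)
  qed
  ultimately show ?thesis
    by (simp add: algebra_simps)
qed

text \<open>Product rule applied to \<open>f y = y powr (- \<beta>) * (y powr \<beta> * f y)\<close>.\<close>
lemma has_vector_derivative_cancel_powr:
  fixes f :: "real \<Rightarrow> complex"
  assumes D: "((\<lambda>y. of_real (y powr \<beta>) * f y) has_vector_derivative D) (at x)" and x: "x > 0"
  shows "(f has_vector_derivative of_real (x powr (- \<beta>)) * D - of_real (\<beta> / x) * f x) (at x)"
proof -
  have cancel: "complex_of_real (y powr (- \<beta>)) * (of_real (y powr \<beta>) * z) = z" if "y > 0" for y z
  proof -
    have "complex_of_real (y powr (- \<beta>)) * of_real (y powr \<beta>) = 1"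
      using powr_minus_cancel[OF that, of \<beta>] by (metis of_real_mult of_real_1)
    then show ?thesis
      by (simp only: mult_1_left flip: mult.assoc)
  qed
  have "((\<lambda>y. of_real (y powr (- \<beta>))) has_vector_derivative
      complex_of_real (- \<beta> * x powr (- \<beta> - 1))) (at x)"
    using x by (intro has_vector_derivative_of_real) (auto intro!: derivative_eq_intros)
  from has_vector_derivative_mult[OF this D]
  have "((\<lambda>y. of_real (y powr (- \<beta>)) * (of_real (y powr \<beta>) * f y)) has_vector_derivative
      of_real (x powr (- \<beta>)) * D
        + of_real (- \<beta> * x powr (- \<beta> - 1)) * (of_real (x powr \<beta>) * f x)) (at x)" .
  moreover have "of_real (- \<beta> * x powr (- \<beta> - 1)) * (of_real (x powr \<beta>) * f x) = - of_real (\<beta> / x) * f x"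
  proof -
    have "x powr (- \<beta> - 1) = x powr (- \<beta>) / x"
      using x by (simp add: powr_diff)
    then have "- \<beta> * x powr (- \<beta> - 1) * x powr \<beta> = - \<beta> / x"
      using powr_minus_cancel[OF x, of \<beta>] by simp
    then have "complex_of_real (- \<beta> * x powr (- \<beta> - 1)) * of_real (x powr \<beta>) = of_real (- \<beta> / x)"
      by (simp only: flip: of_real_mult)
    then show ?thesis
      by (simp add: mult.assoc[symmetric] del: of_real_mult)
  qed
  ultimately have "((\<lambda>y. of_real (y powr (- \<beta>)) * (of_real (y powr \<beta>) * f y)) has_vector_derivative
      of_real (x powr (- \<beta>)) * D - of_real (\<beta> / x) * f x) (at x)"
    by simp
  then show ?thesis
  proof (rule has_vector_derivative_transform_within_open)
    show "open {0::real<..}" "x \<in> {0<..}"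
      using x by auto
    show "of_real (y powr (- \<beta>)) * (of_real (y powr \<beta>) * f y) = f y" if "y \<in> {0<..}" for y
      using that by (intro cancel) simp
  qed
qed

theorem theorem3p1:
  fixes k \<nu> x :: real and c :: complex
  assumes "k > 0" and "2 * \<nu> > - 3 * k" and "x > 0"
  shows "(((\<lambda>y. of_real (y powr (\<nu> / k)) * k_Struve k \<nu> c y) has_vector_derivative
            of_real (1 / k) * of_real (x powr (\<nu> / k)) * k_Struve k (\<nu> - k) c x) (at x)) \<and>
    (((\<lambda>y. of_real (y powr (- \<nu> / k)) * k_Struve k \<nu> c y) has_vector_derivative
            of_real (2 powr (- \<nu> / k)) / (of_real (sqrt pi) * k_Gamma k (of_real (\<nu> + 3 * k / 2)))
              - c * of_real (x powr (- \<nu> / k)) * k_Struve k (\<nu> + k) c x) (at x)) \<and>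
    (k_Struve k \<nu> c differentiable (at x) \<and>
         of_real (1 / k) * k_Struve k (\<nu> - k) c x - c * k_Struve k (\<nu> + k) c x =
           2 * vector_derivative (k_Struve k \<nu> c) (at x)
             - of_real ((x / 2) powr (\<nu> / k))
                 / (of_real (sqrt pi) * k_Gamma k (of_real (\<nu> + 3 * k / 2)))) \<and>
    of_real (1 / k) * k_Struve k (\<nu> - k) c x + c * k_Struve k (\<nu> + k) c x =
           of_real (2 * \<nu> / (x * k)) * k_Struve k \<nu> c x
             + of_real ((x / 2) powr (\<nu> / k))
                 / (of_real (sqrt pi) * k_Gamma k (of_real (\<nu> + 3 * k / 2)))"
proof -
  \<comment> \<open>Each derivative formula is solved for \<open>S'\<close>, giving \<open>S' = L - q * S\<close> and \<open>S' = T - R + q * S\<close>; their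
    sum and difference are the last two relations.\<close>
  define S where "S = k_Struve k \<nu> c"
  define L where "L = of_real (1 / k) * k_Struve k (\<nu> - k) c x"
  define R where "R = c * k_Struve k (\<nu> + k) c x"
  define C where "C = complex_of_real (sqrt pi) * k_Gamma k (of_real (\<nu> + 3 * k / 2))"
  define T where "T = of_real ((x / 2) powr (\<nu> / k)) / C"
  define q where "q = complex_of_real (\<nu> / k / x)"
  note lower = k_Struve_derivative_lower[OF assms(1,3), of \<nu> c]
  note raise = k_Struve_derivative_raise[OF assms(1,3), of \<nu> c]
  have pp: "complex_of_real (x powr (- (\<nu> / k))) * of_real (x powr (\<nu> / k)) = 1"
    using powr_minus_cancel[OF assms(3), of "\<nu> / k"] by (metis of_real_mult of_real_1)
  have "of_real (x powr (- (\<nu> / k))) * (of_real (1 / k) * of_real (x powr (\<nu> / k)) * k_Struve k (\<nu> - k) c x) = L"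
    using pp unfolding L_def by algebra
  then have S1: "(S has_vector_derivative L - q * S x) (at x)"
    using has_vector_derivative_cancel_powr[OF lower assms(3)] by (simp only: S_def q_def)
  have "x powr (\<nu> / k) * 2 powr (- \<nu> / k) = (x / 2) powr (\<nu> / k)"
    using assms by (simp add: powr_half)
  then have "complex_of_real (x powr (\<nu> / k)) * (of_real (2 powr (- \<nu> / k)) / C) = T"
    unfolding T_def by (simp only: times_divide_eq_right flip: of_real_mult)
  moreover have "of_real (x powr (\<nu> / k)) * (c * of_real (x powr (- \<nu> / k)) * k_Struve k (\<nu> + k) c x) = R"
    using pp unfolding R_def minus_divide_left[symmetric] by algebra
  ultimately have "of_real (x powr (\<nu> / k)) * (of_real (2 powr (- \<nu> / k)) / C
      - c * of_real (x powr (- \<nu> / k)) * k_Struve k (\<nu> + k) c x) = T - R"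
    by (simp only: right_diff_distrib)
  then have S2: "(S has_vector_derivative T - R + q * S x) (at x)"
    using has_vector_derivative_cancel_powr[OF raise assms(3)] by (simp add: S_def q_def C_def)
  have d1: "vector_derivative S (at x) = L - q * S x"
    using S1 by (rule vector_derivative_at)
  have d2: "vector_derivative S (at x) = T - R + q * S x"
    using S2 by (rule vector_derivative_at)
  have "S differentiable (at x)"
    using S1 by (rule differentiableI_vector)
  moreover have "L - R = 2 * vector_derivative S (at x) - T"
    using d1 d2 by algebra
  moreover have "L + R = of_real (2 * \<nu> / (x * k)) * S x + T"
  proof -
    have "of_real (2 * \<nu> / (x * k)) = 2 * q"
      by (simp add: q_def)
    then show ?thesis
      using d1 d2 by algebra
  qed
  ultimately show ?thesis
    using lower raise unfolding S_def L_def R_def T_def C_def by blast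
qed

end
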